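(* Let $p_1$ be a prime, $r > 1$ an integer with smallest prime factor $r_1$, and $d$ a positive integer, and let $p' = \min(p_1, r_1)$. Suppose $p_1 r^j + j d$ is prime for every $j = 0, 1, \dots, p'-1$. Then there is no integer $m \ge p'$ such that $p_1 r^j + j d$ is prime for all $j = m, m+1, \dots, m + p' - 1$; that is, the sequence $\{p_1 r^j + j d\}_{j = p'}^{\infty}$ contains no run of $p'$ or more consecutive prime terms.
   Context: A GAP of order $k$ inside the sequence $\{p_1 r^j + jd\}$ means $k$ terms at consecutive indices $j$ that are all prime. *)

theory Defs
  imports "HOL-Computational_Algebra.Primes"
begin

(* GAP of order k whose first index is m. *)
definition prime_gap :: "nat \<Rightarrow> nat \<Rightarrow> nat \<Rightarrow> nat \<Rightarrow> nat \<Rightarrow> bool" where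
  "prime_gap p1 r d m k \<longleftrightarrow> (\<forall>j\<in>{m..<m + k}. prime (p1 * r ^ j + j * d))"

end

theory Submission
  imports Defs
begin

text \<open>
  The number \<open>q = p'\<close> exceeds 1 and divides \<open>p\<^sub>1 r\<close>, hence it divides \<open>p\<^sub>1 r\<^sup>j + j d\<close> for every
  positive multiple \<open>j\<close> of \<open>q\<close>. Any \<open>q\<close> consecutive indices contain such a multiple, and for
  \<open>j \<ge> q\<close> the term exceeds \<open>q\<close>, so it is composite.
\<close>

lemma ex_dvd_atLeastLessThan:
  fixes m q :: nat
  assumes "q > 0"
  shows "\<exists>j\<in>{m..<m + q}. q dvd j"
proof
  let ?j = "(m + q - 1) div q * q"
  have "?j + (m + q - 1) mod q = m + q - 1"
    by (rule div_mult_mod_eq)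
  moreover have "(m + q - 1) mod q < q"
    using assms by simp
  ultimately show "?j \<in> {m..<m + q}"
    unfolding atLeastLessThan_iff using assms by linarith
qed simp

lemma dvd_mult_power:
  fixes a b c :: "'a::comm_semiring_1"
  assumes "a dvd b * c" and "n > 0"
  shows "a dvd b * c ^ n"
proof -
  have "b * c dvd b * c ^ n"
    using \<open>n > 0\<close> by (intro mult_dvd_mono dvd_power) simp_all
  with \<open>a dvd b * c\<close> show ?thesis
    by (rule dvd_trans)
qed

lemma less_mult_power_add:
  fixes a r j b :: nat
  assumes "a > 0" and "r > 1"
  shows "j < a * r ^ j + b"
proof -
  have "j < r ^ j"
    using \<open>r > 1\<close> by (simp add: power_gt_expt)
  also have "\<dots> \<le> a * r ^ j + b"
    using \<open>a > 0\<close> by (simp add: trans_le_add1)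
  finally show ?thesis .
qed

lemma not_prime_mult_power_add:
  fixes a r d j q :: nat
  assumes "a > 0" and "r > 1" and "q > 1" and "q dvd a * r" and "q dvd j" and "q \<le> j"
  shows "\<not> prime (a * r ^ j + j * d)"
proof -
  have "q dvd a * r ^ j"
    using assms by (intro dvd_mult_power) simp_all
  moreover have "q dvd j * d"
    using \<open>q dvd j\<close> by (rule dvd_mult2)
  ultimately have "q dvd a * r ^ j + j * d"
    by (rule dvd_add)
  moreover have "q < a * r ^ j + j * d"
    using \<open>q \<le> j\<close> less_mult_power_add[OF \<open>a > 0\<close> \<open>r > 1\<close>] by (rule le_less_trans)
  ultimately show ?thesis
    using \<open>q > 1\<close> prime_nat_not_dvd by blast
qed

lemma prime_gap_order_less:
  fixes a r d m k q :: nat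
  assumes "prime_gap a r d m k"
    and "a > 0" and "r > 1" and "q > 1" and "q dvd a * r" and "q \<le> m"
  shows "k < q"
proof (rule ccontr)
  assume "\<not> k < q"
  obtain j where "j \<in> {m..<m + q}" and "q dvd j"
    using ex_dvd_atLeastLessThan[of q m] \<open>q > 1\<close> by auto
  then have "\<not> prime (a * r ^ j + j * d)"
    using assms(2-) by (intro not_prime_mult_power_add[where q = q]) simp_all
  moreover have "j \<in> {m..<m + k}"
    using \<open>j \<in> {m..<m + q}\<close> \<open>\<not> k < q\<close> by simp
  ultimately show False
    using \<open>prime_gap a r d m k\<close> by (auto simp: prime_gap_def)
qed

lemma Min_prime_factors_in:
  fixes n :: nat
  assumes "n > 1"
  shows "Min (prime_factors n) \<in> prime_factors n"
proof (rule Min_in)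
  show "prime_factors n \<noteq> {}"
    using assms by (simp add: prime_factorization_empty_iff)
qed simp

theorem theorem3:
  fixes p1 r r1 d p' :: nat
  assumes "prime p1"
    and "r > 1"
    and "r1 = Min (prime_factors r)"
    and "d > 0"
    and "p' = min p1 r1"
    and "\<forall>j\<in>{0..<p'}. prime (p1 * r ^ j + j * d)"
  shows "\<not> (\<exists>m\<ge>p'. \<forall>j\<in>{m..<m + p'}. prime (p1 * r ^ j + j * d))
    \<and> \<not> (\<exists>m\<ge>p'. \<exists>k\<ge>p'. prime_gap p1 r d m k)"
proof -
  have "r1 \<in> prime_factors r"
    using \<open>r1 = _\<close> Min_prime_factors_in[OF \<open>r > 1\<close>] by simp
  then have "prime p'" and "p' dvd p1 * r"
    using \<open>prime p1\<close> \<open>p' = _\<close> by (auto simp: min_def)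
  have "k < p'" if "prime_gap p1 r d m k" and "m \<ge> p'" for m k
    using that(1) prime_gt_0_nat[OF \<open>prime p1\<close>] \<open>r > 1\<close> prime_gt_1_nat[OF \<open>prime p'\<close>]
      \<open>p' dvd p1 * r\<close> that(2)
    by (rule prime_gap_order_less)
  then show ?thesis
    unfolding prime_gap_def[symmetric] by (meson less_irrefl not_less)
qed

end
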